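(* The only solutions $(k,m,n)$ in the positive integers of the exponential Diophantine equation $3^k(2^m - 1) = 2^n - 1$ are $(k,m,n) = (1,1,2)$ and $(k,m,n) = (2,3,6)$. *)

theory Defs
  imports Main
begin

end

theory Submission
  imports Defs
begin

text \<open>
  The factor \<open>3 ^ k\<close> is too large to divide \<open>2 ^ n - 1\<close> unless \<open>n\<close> is small.
  Reduction modulo 3 forces \<open>n = 2 * j\<close>, and the order of 4 modulo \<open>3 ^ k\<close> is \<open>3 ^ (k - 1)\<close>
  (\<open>three_power_dvd_exponent\<close>), so that \<open>3 ^ k \<le> 3 * j\<close>.
  On the other hand \<open>2 ^ m - 1\<close> is a proper divisor of \<open>2 ^ n - 1\<close>, hence \<open>m \<le> j\<close>
  (\<open>mersenne_proper_divisor_exponent\<close>), and the quotient \<open>3 ^ k\<close> is at least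
  \<open>(4 ^ j - 1) / (2 ^ j - 1) = 2 ^ j + 1\<close>. The inequality \<open>2 ^ j + 1 \<le> 3 * j\<close> leaves
  only \<open>j \<le> 3\<close>, which is a finite check.
\<close>

lemma four_power_mod_9:
  "(4::int) ^ j mod 9 = (if j mod 3 = 0 then 1 else if j mod 3 = 1 then 4 else 7)"
proof -
  have "(4::int) ^ j = 64 ^ (j div 3) * 4 ^ (j mod 3)"
    using power_add[of "4::int" "3 * (j div 3)" "j mod 3"] by (simp add: power_mult)
  moreover have "(64::int) ^ i mod 9 = 1" for i
    using power_mod[of "64::int" 9 i] by simp
  ultimately have "(4::int) ^ j mod 9 = 4 ^ (j mod 3) mod 9"
    by (metis mod_mult_left_eq mult_1)
  moreover have "j mod 3 = 0 \<or> j mod 3 = 1 \<or> j mod 3 = 2" by arith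
  ultimately show ?thesis by auto
qed

text \<open>
  Lifting the exponent for the base 4: tripling the exponent multiplies \<open>4 ^ i - 1\<close> by
  \<open>y\<^sup>2 + y + 1\<close> with \<open>y = 4 ^ i \<equiv> 1\<close> modulo 3, which is 3 times a number prime to 3. Each
  further factor 3 of \<open>4 ^ j - 1\<close> therefore costs exactly one factor 3 of \<open>j\<close>.
\<close>

lemma three_power_dvd_exponent:
  fixes j k :: nat
  assumes "(3::int) ^ Suc k dvd 4 ^ j - 1"
  shows "3 ^ k dvd j"
  using assms
proof (induction k arbitrary: j)
  case 0
  show ?case by simp
next
  case (Suc k)
  have "(9::int) dvd 3 ^ Suc (Suc k)" by simp
  with Suc.prems have "(9::int) dvd 4 ^ j - 1" by (rule dvd_trans[rotated])
  then have "(4::int) ^ j mod 9 = 1 mod 9" by (simp only: mod_eq_dvd_iff)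
  then have "j mod 3 = 0" by (auto simp: four_power_mod_9 split: if_splits)
  then obtain i where j: "j = 3 * i" by auto
  have "(4::int) ^ i mod 3 = 1" using power_mod[of "4::int" 3 i] by simp
  then have "(4::int) ^ i = 1 + 3 * (4 ^ i div 3)"
    using div_mult_mod_eq[of "(4::int) ^ i" 3] by linarith
  then obtain z :: int where z: "4 ^ i = 1 + 3 * z" by blast
  define c where "c = 1 + 3 * (z + z\<^sup>2)"
  have "(4::int) ^ j - 1 = (4 ^ i) ^ 3 - 1" by (simp add: j power_mult[symmetric] mult.commute)
  also have "\<dots> = 3 * (c * (4 ^ i - 1))"
    unfolding z c_def by (simp add: algebra_simps power2_eq_square power3_eq_cube)
  finally have "3 * 3 ^ Suc k dvd 3 * (c * (4 ^ i - 1))" using Suc.prems by (simp only: power_Suc)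
  then have "3 ^ Suc k dvd c * (4 ^ i - 1)" by (subst (asm) dvd_times_left_cancel_iff) auto
  moreover have "coprime (3 ^ Suc k) c"
  proof -
    have "coprime 3 c" unfolding c_def
      by (metis coprime_1_right coprime_iff_gcd_eq_1 gcd_add_mult mult.commute add.commute)
    then show ?thesis by (rule coprime_power_left_iff[THEN iffD2, OF disjI1])
  qed
  ultimately have "3 ^ Suc k dvd (4::int) ^ i - 1" by (simp add: coprime_dvd_mult_right_iff)
  from Suc.IH[OF this] show ?case by (simp add: j)
qed

lemma three_dvd_mersenne_imp_even:
  assumes "(3::int) dvd 2 ^ n - 1"
  shows "even n"
proof (rule ccontr)
  assume "odd n"
  then obtain i where "n = 2 * i + 1" by (auto elim: oddE)
  then have "(2::int) ^ n mod 3 = 2 * (4 ^ i mod 3) mod 3"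
    by (simp add: power_mult mod_simps)
  also have "(4::int) ^ i mod 3 = 1" using power_mod[of "4::int" 3 i] by simp
  finally show False using assms by presburger
qed

text \<open>
  Subtracting \<open>2 ^ (n - m) * (2 ^ m - 1)\<close> from \<open>2 ^ n - 1\<close> shows that \<open>2 ^ m - 1\<close> also divides
  the positive number \<open>2 ^ (n - m) - 1\<close>, which bounds \<open>m\<close> by \<open>n - m\<close>.
\<close>

lemma mersenne_proper_divisor_exponent:
  fixes m n :: nat
  assumes "(2::int) ^ m - 1 dvd 2 ^ n - 1" and "m < n"
  shows "2 * m \<le> n"
proof -
  have "(2::int) ^ n = 2 ^ (n - m) * 2 ^ m" using assms(2) by (simp flip: power_add)
  then have "(2::int) ^ (n - m) - 1 = (2 ^ n - 1) - 2 ^ (n - m) * (2 ^ m - 1)"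
    by (simp add: algebra_simps)
  with assms(1) have "(2::int) ^ m - 1 dvd 2 ^ (n - m) - 1"
    by (metis dvd_diff dvd_triv_right)
  moreover have "(1::int) < 2 ^ (n - m)" using assms(2) by simp
  ultimately have "(2::int) ^ m - 1 \<le> 2 ^ (n - m) - 1" by (intro zdvd_imp_le) auto
  then have "(2::int) ^ m \<le> 2 ^ (n - m)" by linarith
  then have "m \<le> n - m" by simp
  then show ?thesis using assms(2) by linarith
qed

lemma three_mult_le_two_power:
  fixes j :: nat
  assumes "4 \<le> j"
  shows "3 * j \<le> 2 ^ j"
  using assms by (induction j rule: nat_induct_at_least) auto

text \<open>The two bounds on \<open>3 ^ k\<close> described above confine \<open>k\<close>, \<open>m\<close> and \<open>n\<close>.\<close>

lemma solution_bounds: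
  fixes k m n :: nat
  assumes k: "0 < k" and m: "0 < m" and eq: "(3::int) ^ k * (2 ^ m - 1) = 2 ^ n - 1"
  obtains j where "n = 2 * j" "m \<le> j" "j \<le> 3" "k \<le> 2"
proof -
  obtain k' where k': "k = Suc k'" using k gr0_conv_Suc by blast
  have dvd: "(3::int) ^ k dvd 2 ^ n - 1" "(2::int) ^ m - 1 dvd 2 ^ n - 1"
    by (simp_all flip: eq)
  have "(3::int) dvd 2 ^ n - 1" using dvd(1) by (rule dvd_trans[rotated]) (simp add: k')
  then obtain j where n: "n = 2 * j" using three_dvd_mersenne_imp_even by blast
  have pos: "(0::int) < 2 ^ m - 1" using m by simp
  have "(1::int) < 3 ^ k" using k by simp
  then have "1 * ((2::int) ^ m - 1) < 3 ^ k * (2 ^ m - 1)" using pos by (rule mult_strict_right_mono)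
  then have "(2::int) ^ m < 2 ^ n" unfolding eq by simp
  then have "m < n" by simp
  with dvd(2) have mj: "m \<le> j" using mersenne_proper_divisor_exponent n by fastforce
  have j0: "0 < j" using m mj by simp
  have four: "(2::int) ^ n = 4 ^ j" by (simp add: n power_mult)
  have "3 ^ k' dvd j" using three_power_dvd_exponent dvd(1) by (simp only: four k')
  then have "3 ^ k' \<le> j" using j0 by (simp add: dvd_imp_le)
  then have up: "3 ^ k \<le> 3 * j" by (simp add: k')
  have "((2::int) ^ j + 1) * (2 ^ j - 1) = 2 ^ n - 1"
    by (simp add: n algebra_simps power_mult power2_eq_square flip: power_mult_distrib)
  also have "\<dots> \<le> 3 ^ k * (2 ^ j - 1)"
    unfolding eq[symmetric] using mj by (intro mult_left_mono diff_right_mono power_increasing) auto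
  finally have "(2::int) ^ j + 1 \<le> 3 ^ k" using j0 by (simp add: mult_le_cancel_right)
  then have "int (2 ^ j + 1) \<le> int (3 ^ k)" by simp
  then have "2 ^ j + 1 \<le> (3::nat) ^ k" by (simp only: of_nat_le_iff)
  with up have "\<not> 4 \<le> j" using three_mult_le_two_power[of j] by linarith
  then have j3: "j \<le> 3" by simp
  have "(3::nat) ^ k \<le> 3 ^ 2" using up j3 by simp
  then have "k \<le> 2" by (subst (asm) power_increasing_iff) auto
  with n mj j3 show ?thesis by (rule that)
qed

theorem proposition7:
  shows "{(k :: nat, m :: nat, n :: nat).
            0 < k \<and> 0 < m \<and> 0 < n \<and> (3 :: int) ^ k * (2 ^ m - 1) = 2 ^ n - 1}
          = {(1, 1, 2), (2, 3, 6)}"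
proof -
  have "k = 1 \<and> m = 1 \<and> n = 2 \<or> k = 2 \<and> m = 3 \<and> n = 6"
    if pos: "0 < k" "0 < m" and eq: "(3::int) ^ k * (2 ^ m - 1) = 2 ^ n - 1" for k m n :: nat
  proof -
    obtain j where n: "n = 2 * j" and b: "m \<le> j" "j \<le> 3" "k \<le> 2"
      using solution_bounds[OF pos eq] .
    have "k = 1 \<or> k = 2" "m = 1 \<or> m = 2 \<or> m = 3" "j = 1 \<or> j = 2 \<or> j = 3"
      using pos b by linarith+
    then show ?thesis using eq b(1) unfolding n by auto
  qed
  then show ?thesis by auto
qed

end
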